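(* For every integer $k\ge 4$, $f(k)\le 15\,n_3(2^{k-2}+1)$. In particular $f(6)\le 15\cdot 2176=32\,640$.
   Context: Graphs are finite, simple and undirected; the girth of a graph is the length of a shortest cycle. $f(k)$ denotes the order (number of vertices) of a smallest cubic graph with no cycle of length $2^m$ for any $m\le k$. $n_3(g)$ denotes the order of the smallest known cubic graph of girth $g$; values are tabulated in the Exoo–Jajcay dynamic cage survey, and $n_3(17)=2176$. *)

theory Defs
  imports "Graph_Theory.Graph_Theory" "HOL-Library.Extended_Nat"
begin

text \<open>
  A finite simple undirected graph is a \<^locale>\<open>pair_graph\<close>: a finite, loop-free, symmetric
  digraph in which the undirected edge \<open>{u, v}\<close> is the pair of arcs \<open>(u, v)\<close>, \<open>(v, u)\<close>.
  Vertices are natural numbers, which loses nothing for finite graphs up to isomorphism.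

  The null graph would be vacuously cubic of order 0 and is excluded.
\<close>

definition cubic_graph :: "nat pair_pre_digraph \<Rightarrow> bool" where
  "cubic_graph G \<longleftrightarrow>
     pair_graph G \<and> pverts G \<noteq> {} \<and> (\<forall>v \<in> pverts G. out_degree (with_proj G) v = 3)"

abbreviation graph_order :: "'a pair_pre_digraph \<Rightarrow> nat" where
  "graph_order G \<equiv> card (pverts G)"

text \<open>
  A directed cycle of a symmetric digraph may have length 2, running back and forth along one
  edge. The directed cycles of length at least 3 are exactly the cycles of the undirected graph,
  each with a choice of starting point and direction.
\<close>

definition has_cycle_of_length :: "'a pair_pre_digraph \<Rightarrow> nat \<Rightarrow> bool" where
  "has_cycle_of_length G l \<longleftrightarrow>
     l \<ge> 3 \<and> (\<exists>p. pre_digraph.cycle (with_proj G) p \<and> length p = l)"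

text \<open>The girth of a forest is \<open>\<infinity>\<close>, the infimum of the empty set.\<close>

definition girth :: "'a pair_pre_digraph \<Rightarrow> enat" where
  "girth G = Inf {enat l | l. has_cycle_of_length G l}"

text \<open>
  \<open>f(k)\<close> in the paper. Without any admissible graph the value would be \<open>\<infinity>\<close>, so a finite upper
  bound on it asserts in particular that such a graph exists. The exponents \<open>m = 0, 1\<close> are
  harmless, as \<^const>\<open>has_cycle_of_length\<close> is false for lengths 1 and 2.
\<close>

definition pow2_free_order :: "nat \<Rightarrow> enat" where
  "pow2_free_order k = Inf {enat (graph_order G) | G.
                cubic_graph G \<and> (\<forall>m \<le> k. \<not> has_cycle_of_length G (2 ^ m))}"

text \<open>
  The number \<open>n\<^sub>3(g)\<close>, the order of the smallest \<^emph>\<open>known\<close> cubic graph of girth \<open>g\<close>, depends on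
  the state of the tables. All that is mathematically determined about such an entry \<open>n\<close> is that
  it is the order of some cubic graph of girth \<open>g\<close>, which is what this predicate says.
\<close>

definition cubic_girth_order :: "nat \<Rightarrow> nat \<Rightarrow> bool" where
  "cubic_girth_order g n \<longleftrightarrow> (\<exists>G. cubic_graph G \<and> girth G = enat g \<and> graph_order G = n)"

end

theory Submission
  imports Defs
begin

text \<open>
  Replace every vertex of a cubic graph by a gadget on 15 vertices, three of them of degree 2 and at
  mutual distances 3, 3 and 5, which has no cycles of length 4 or 8. A cycle of the new graph either
  stays inside a gadget, or passes through pairwise distinct gadgets and traces a cycle of the old
  graph, each passage costing at least 4 edges. Girth \<open>2\<^bsup>k - 2\<^esup> + 1\<close> thus gives length more than \<open>2\<^sup>k\<close>.

  For \<open>k = 6\<close> no cubic graph of girth 17 is needed: a passage between the gadget vertices at distance 5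
  costs 6 edges, and there is a cubic graph on 1332 vertices in which, for a suitable choice of the
  expensive passages, every cycle costs more than 64.
\<close>

section \<open>Cycles as periodic sequences\<close>

text \<open>Within a gadget only lengths 4 and 8 need excluding, as 15 vertices carry no cycle of
  length 16. The bound for exponent 6 is unconditional, so a graph must be exhibited and all its
  cycles checked. Algebra keeps this small: in the base graph a closed word makes an alternating sum
  of powers of 17 vanish modulo 37, and a cost of at most 64 leaves at most six summands with
  exponents close together, few enough for a search by rewriting. The 6-edge passages are placed so
  that the surcharge of a closed word is 2 per flip.\<close>

definition cyclic_seq :: "'a rel \<Rightarrow> nat \<Rightarrow> (nat \<Rightarrow> 'a) \<Rightarrow> bool" where
  "cyclic_seq A l x \<longleftrightarrow>
     0 < l \<and> (\<forall>i. x (i + l) = x i) \<and> (\<forall>i. (x i, x (Suc i)) \<in> A) \<and> inj_on x {..<l}"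

lemma cyclic_seq_mod:
  assumes "cyclic_seq A l x"
  shows "x (i mod l) = x i"
proof -
  have "x (j + k * l) = x j" for j k
  proof (induction k)
    case (Suc k)
    have "x (j + Suc k * l) = x (j + k * l + l)"
      by (simp add: algebra_simps)
    also have "\<dots> = x (j + k * l)"
      using assms unfolding cyclic_seq_def by blast
    finally show ?case
      using Suc by simp
  qed simp
  from this[of "i mod l" "i div l"] show ?thesis by simp
qed

lemma cyclic_seq_eq_iff:
  assumes "cyclic_seq A l x"
  shows "x i = x j \<longleftrightarrow> i mod l = j mod l"
proof
  assume "x i = x j"
  then have "x (i mod l) = x (j mod l)"
    using cyclic_seq_mod[OF assms] by simp
  moreover have "i mod l < l" "j mod l < l"
    using assms by (auto simp: cyclic_seq_def)
  ultimately show "i mod l = j mod l"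
    using assms by (auto simp: cyclic_seq_def dest: inj_onD)
next
  assume "i mod l = j mod l"
  then show "x i = x j"
    by (metis cyclic_seq_mod[OF assms])
qed

text \<open>Periodicity over all naturals lets a cycle be restarted at any of its vertices without
  wraparound cases.\<close>

lemma cyclic_seq_shift:
  assumes "cyclic_seq A l x"
  shows "cyclic_seq A l (\<lambda>i. x (i + s))"
proof -
  have "inj_on (\<lambda>i. x (i + s)) {..<l}"
  proof (rule inj_onI)
    fix i j assume ij: "i \<in> {..<l}" "j \<in> {..<l}" "x (i + s) = x (j + s)"
    then have "(i + s) mod l = (j + s) mod l"
      using cyclic_seq_eq_iff[OF assms] by simp
    \<comment> \<open>Adding \<open>s * l - s\<close> completes the offset \<open>s\<close> to a
      multiple of \<open>l\<close>, which cancels it without subtraction modulo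
      \<open>l\<close>.\<close>
    then have "(i + s + (s * l - s)) mod l = (j + s + (s * l - s)) mod l"
      by (rule mod_add_cong) simp
    moreover have "k + s + (s * l - s) = k + s * l" for k
      using assms by (cases l) (simp_all add: cyclic_seq_def)
    ultimately show "i = j"
      using ij by simp
  qed
  moreover have "x (i + l + s) = x (i + s)" for i
    using assms cyclic_seq_def[of A l x] by (metis add.assoc add.commute)
  ultimately show ?thesis
    using assms unfolding cyclic_seq_def by simp
qed

lemma pcas_nth:
  "pcas u p v \<Longrightarrow> i < length p \<Longrightarrow>
     fst (p ! i) = (case i of 0 \<Rightarrow> u | Suc j \<Rightarrow> snd (p ! j)) \<and> snd (last p) = v"
proof (induction p arbitrary: u i)
  case (Cons e p)
  show ?case
  proof (cases p)
    case Nil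
    then show ?thesis using Cons.prems by simp
  next
    case (Cons e' p')
    have "pcas (snd e) p v" using Cons.prems by simp
    from Cons.IH[OF this, of 0] Cons.IH[OF this, of "i - 1"] Cons.prems Cons show ?thesis
      by (cases i) (auto split: nat.splits)
  qed
qed simp

lemma pcas_map_upt: "pcas (x m) (map (\<lambda>i. (x i, x (Suc i))) [m..<m + n]) (x (m + n))"
proof (induction n arbitrary: m)
  case (Suc n)
  have "[m..<m + Suc n] = m # [Suc m..<Suc m + n]"
    by (simp add: upt_conv_Cons)
  then show ?case
    using Suc[of "Suc m"] by simp
qed simp

text \<open>\<open>cycle\<close> requires distinctness of all visited vertices but the first. These
  are the heads of the arcs, so the sequence is read off the heads.\<close>

lemma has_cycle_of_length_iff:
  assumes "pair_wf_digraph G"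
  shows "has_cycle_of_length G l \<longleftrightarrow> 3 \<le> l \<and> (\<exists>x. cyclic_seq (parcs G) l x)"
proof -
  interpret pair_wf_digraph G by (rule assms)
  have "\<exists>x. cyclic_seq (parcs G) (length p) x" if "cycle p" for p
  proof -
    from that obtain u where p: "awalk u p u" "distinct (tl (pawalk_verts u p))" "p \<noteq> []"
      by (auto simp: cycle_def)
    then have cas: "pcas u p u" and arcs: "set p \<subseteq> parcs G"
      by (auto simp: awalk_def)
    have heads: "distinct (map snd p)"
      using p(2) awalk_verts_conv'[OF cas] p(3) by simp
    let ?l = "length p"
    let ?x = "\<lambda>i. snd (p ! (i mod ?l))"
    have pos: "0 < ?l" using p(3) by simp
    have "(?x i, ?x (Suc i)) \<in> parcs G" for i
    proof -
      let ?j = "Suc i mod ?l"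
      have "?j < ?l" using pos by simp
      then have "fst (p ! ?j) = ?x i"
        using pcas_nth[OF cas, of ?j] pos p(3)
        by (auto simp: mod_Suc last_conv_nth split: if_splits) (metis diff_Suc_Suc diff_zero)
      moreover have "p ! ?j \<in> parcs G" using arcs \<open>?j < ?l\<close> by auto
      ultimately show ?thesis by (metis prod.collapse)
    qed
    moreover have "inj_on ?x {..<?l}"
      using heads by (auto simp: inj_on_def distinct_conv_nth)
    ultimately have "cyclic_seq (parcs G) ?l ?x"
      using pos by (simp add: cyclic_seq_def)
    then show ?thesis by blast
  qed
  moreover have "\<exists>p. cycle p \<and> length p = l" if x: "cyclic_seq (parcs G) l x" for x
  proof -
    let ?p = "map (\<lambda>i. (x i, x (Suc i))) [0..<l]"
    have l: "0 < l" "x l = x 0"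
      using x unfolding cyclic_seq_def by (auto dest: spec[of _ 0])
    have arcs: "\<And>i. (x i, x (Suc i)) \<in> parcs G"
      using x by (simp add: cyclic_seq_def)
    have cas: "pcas (x 0) ?p (x 0)"
      using pcas_map_upt[of x 0 l] l(2) by simp
    have "x 0 \<in> pverts G" using arcs[of 0] by (rule in_arcsD1)
    then have "awalk (x 0) ?p (x 0)"
      using cas arcs by (auto simp: awalk_def)
    moreover have "inj_on (\<lambda>i. x (i + 1)) {..<l}"
      using cyclic_seq_shift[OF x, of 1] by (simp add: cyclic_seq_def)
    then have "distinct (map snd ?p)"
      by (simp add: distinct_map comp_def atLeast0LessThan)
    then have "distinct (tl (pawalk_verts (x 0) ?p))"
      using awalk_verts_conv'[OF cas] l(1) by simp
    ultimately have "cycle ?p" using l(1) by (auto simp: cycle_def)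
    then show ?thesis by (intro exI[of _ ?p]) simp
  qed
  ultimately show ?thesis
    unfolding has_cycle_of_length_def by blast
qed

text \<open>\<open>cubic_graph\<close> is fixed to vertices in \<open>nat\<close>, whereas the
  constructed graph has pairs as vertices. An injection into \<open>nat\<close> transports the
  degrees, and cycles are pulled back along it.\<close>

lemma pow2_free_order_le:
  assumes G: "pair_graph G" "pverts G \<noteq> {}"
    and deg: "\<And>v. v \<in> pverts G \<Longrightarrow> out_degree (with_proj G) v = 3"
    and free: "\<And>m. m \<le> k \<Longrightarrow> \<not> has_cycle_of_length G (2 ^ m)"
  shows "pow2_free_order k \<le> enat (card (pverts G))"
proof -
  interpret pair_graph G by (rule G(1))
  obtain f :: "'a \<Rightarrow> nat" where inj: "inj_on f (pverts G)"
    using finite_imp_inj_to_nat_seg[OF pair_finite_verts] by blast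
  have inj_iff: "f u = f v \<longleftrightarrow> u = v" if "u \<in> pverts G" "v \<in> pverts G" for u v
    using inj that by (auto dest: inj_onD)
  define H where "H = \<lparr>pverts = f ` pverts G, parcs = map_prod f f ` parcs G\<rparr>"
  have verts: "pverts H = f ` pverts G" and arcs: "parcs H = map_prod f f ` parcs G"
    by (simp_all add: H_def)
  have arc_iff: "(f u, f v) \<in> parcs H \<longleftrightarrow> (u, v) \<in> parcs G" if "u \<in> pverts G" "v \<in> pverts G" for u v
    using that inj_iff in_arcsD1 in_arcsD2 by (auto simp: arcs map_prod_def)
  have "pair_graph H"
  proof (unfold_locales)
    show "symmetric (with_proj H)"
      using arcs_symmetric by (auto simp: symmetric_def arcs sym_def)
    show "fst e \<noteq> snd e" if "e \<in> parcs H" for e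
      using that inj_iff no_loops' in_arcsD1 in_arcsD2 by (fastforce simp: arcs)
  qed (use pair_finite_verts pair_finite_arcs in_arcsD1 in_arcsD2 in \<open>auto simp: verts arcs\<close>)
  then interpret H: pair_graph H .
  have "out_degree (with_proj H) (f v) = 3" if v: "v \<in> pverts G" for v
  proof -
    have "out_arcs (with_proj H) (f v) = map_prod f f ` out_arcs (with_proj G) v"
      using v inj_iff in_arcsD1 by (auto simp: out_arcs_def arcs)
    moreover have "inj_on (map_prod f f) (out_arcs (with_proj G) v)"
      using inj_iff in_arcsD1 in_arcsD2 by (auto simp: inj_on_def out_arcs_def)
    ultimately show ?thesis
      using deg[OF v] by (simp add: out_degree_def card_image)
  qed
  then have "cubic_graph H"
    using G(2) H.pair_graph by (auto simp: cubic_graph_def verts)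
  moreover have "\<not> has_cycle_of_length H (2 ^ m)" if m: "m \<le> k" for m
  proof
    let ?l = "2 ^ m :: nat"
    assume "has_cycle_of_length H ?l"
    then obtain x where l: "3 \<le> ?l" and x: "cyclic_seq (parcs H) ?l x"
      using has_cycle_of_length_iff[OF H.pair_wf_digraph] by blast
    have "x i \<in> f ` pverts G" for i
      using x H.in_arcsD1[of "x i" "x (Suc i)"] by (simp add: cyclic_seq_def verts)
    then have "\<forall>i. \<exists>v. v \<in> pverts G \<and> f v = x i"
      by (auto simp: image_iff) metis
    then obtain y where y: "\<And>i. y i \<in> pverts G" "\<And>i. f (y i) = x i"
      by metis
    have "y i = y j \<longleftrightarrow> x i = x j" for i j
      using y inj_iff by metis
    moreover have "(y i, y (Suc i)) \<in> parcs G" for i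
      using x arc_iff[of "y i" "y (Suc i)"] y by (simp add: cyclic_seq_def)
    ultimately have "cyclic_seq (parcs G) ?l y"
      using x by (simp add: cyclic_seq_def inj_on_def)
    then show False
      using free[OF m] l has_cycle_of_length_iff[OF pair_wf_digraph] by blast
  qed
  moreover have "graph_order H = card (pverts G)"
    by (simp add: verts card_image inj)
  ultimately show ?thesis
    unfolding pow2_free_order_def by (intro Inf_lower) force
qed

section \<open>The gadget\<close>

text \<open>
  The gadget arises from a cubic graph on 16 vertices by deleting a vertex, whose neighbours
  0, 1, 2 become the ports. It was found by exhaustive search.
\<close>

definition gadget_nbrs :: "nat list list" where
  "gadget_nbrs =
    [[3, 4], [5, 6], [7, 8], [0, 5, 9], [0, 7, 10], [1, 3, 9], [1, 11, 12], [2, 4, 10],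
     [2, 13, 14], [3, 5, 11], [4, 7, 13], [6, 9, 12], [6, 11, 14], [8, 10, 14], [8, 12, 13]]"

definition gadget_arcs :: "nat rel" where
  "gadget_arcs = {(i, j). i < 15 \<and> j \<in> set (gadget_nbrs ! i)}"

text \<open>Breadth-first distances from the ports, one row per port. They serve as a potential that
  rises by at most 1 along an arc and so bounds walk lengths from below.\<close>

definition gadget_dist :: "nat \<Rightarrow> nat \<Rightarrow> nat" where
  "gadget_dist q i =
    (if q = 0 then [0, 3, 3, 1, 1, 2, 4, 2, 4, 2, 2, 3, 4, 3, 4]
     else if q = 1 then [3, 0, 5, 2, 4, 1, 1, 5, 4, 2, 5, 2, 2, 4, 3]
     else [3, 5, 0, 4, 2, 5, 4, 1, 1, 5, 2, 4, 3, 2, 2]) ! i"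

lemma lessThan_15: "{..<15} = {0, 1, 2, 3, 4, 5, 6, 7, 8, 9, 10, 11, 12, 13, 14 :: nat}"
  by (auto simp: less_Suc_eq numeral_eq_Suc)

lemma gadget_nbrs_nth [simp]:
  "gadget_nbrs ! 0 = [3, 4]"
  "gadget_nbrs ! Suc 0 = [5, 6]"
  "gadget_nbrs ! 2 = [7, 8]"
  "gadget_nbrs ! 3 = [0, 5, 9]"
  "gadget_nbrs ! 4 = [0, 7, 10]"
  "gadget_nbrs ! 5 = [1, 3, 9]"
  "gadget_nbrs ! 6 = [1, 11, 12]"
  "gadget_nbrs ! 7 = [2, 4, 10]"
  "gadget_nbrs ! 8 = [2, 13, 14]"
  "gadget_nbrs ! 9 = [3, 5, 11]"
  "gadget_nbrs ! 10 = [4, 7, 13]"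
  "gadget_nbrs ! 11 = [6, 9, 12]"
  "gadget_nbrs ! 12 = [6, 11, 14]"
  "gadget_nbrs ! 13 = [8, 10, 14]"
  "gadget_nbrs ! 14 = [8, 12, 13]"
  by (simp_all add: gadget_nbrs_def)

lemma gadget_dist_nth:
  "gadget_dist 0 0 = 0"
  "gadget_dist 0 (Suc 0) = 3"
  "gadget_dist 0 2 = 3"
  "gadget_dist 0 3 = 1"
  "gadget_dist 0 4 = 1"
  "gadget_dist 0 5 = 2"
  "gadget_dist 0 6 = 4"
  "gadget_dist 0 7 = 2"
  "gadget_dist 0 8 = 4"
  "gadget_dist 0 9 = 2"
  "gadget_dist 0 10 = 2"
  "gadget_dist 0 11 = 3"
  "gadget_dist 0 12 = 4"
  "gadget_dist 0 13 = 3"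
  "gadget_dist 0 14 = 4"
  "gadget_dist (Suc 0) 0 = 3"
  "gadget_dist (Suc 0) (Suc 0) = 0"
  "gadget_dist (Suc 0) 2 = 5"
  "gadget_dist (Suc 0) 3 = 2"
  "gadget_dist (Suc 0) 4 = 4"
  "gadget_dist (Suc 0) 5 = 1"
  "gadget_dist (Suc 0) 6 = 1"
  "gadget_dist (Suc 0) 7 = 5"
  "gadget_dist (Suc 0) 8 = 4"
  "gadget_dist (Suc 0) 9 = 2"
  "gadget_dist (Suc 0) 10 = 5"
  "gadget_dist (Suc 0) 11 = 2"
  "gadget_dist (Suc 0) 12 = 2"
  "gadget_dist (Suc 0) 13 = 4"
  "gadget_dist (Suc 0) 14 = 3"
  "gadget_dist 2 0 = 3"
  "gadget_dist 2 (Suc 0) = 5"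
  "gadget_dist 2 2 = 0"
  "gadget_dist 2 3 = 4"
  "gadget_dist 2 4 = 2"
  "gadget_dist 2 5 = 5"
  "gadget_dist 2 6 = 4"
  "gadget_dist 2 7 = 1"
  "gadget_dist 2 8 = 1"
  "gadget_dist 2 9 = 5"
  "gadget_dist 2 10 = 2"
  "gadget_dist 2 11 = 4"
  "gadget_dist 2 12 = 3"
  "gadget_dist 2 13 = 2"
  "gadget_dist 2 14 = 2"
  by (simp_all add: gadget_dist_def)

(* Keeps the simplifier from unfolding a search at a symbolic vertex before the range is enumerated. *)
lemma ball_weak_cong: "A = B \<Longrightarrow> Ball A P \<longleftrightarrow> Ball B P"
  by simp

lemma gadget_arcs_props:
  assumes "(i, j) \<in> gadget_arcs"
  shows "i < 15" "j < 15" "i \<noteq> j" "(j, i) \<in> gadget_arcs"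
    and "q < 3 \<Longrightarrow> gadget_dist q j \<le> gadget_dist q i + 1"
proof -
  have i: "i \<in> {..<15}" and j: "j \<in> set (gadget_nbrs ! i)"
    using assms by (simp_all only: gadget_arcs_def mem_Collect_eq case_prod_conv lessThan_iff)
  have less: "\<forall>i \<in> {..<15}. \<forall>j \<in> set (gadget_nbrs ! i). j < 15"
    and neq: "\<forall>i \<in> {..<15}. \<forall>j \<in> set (gadget_nbrs ! i). i \<noteq> j"
    and sym: "\<forall>i \<in> {..<15}. \<forall>j \<in> set (gadget_nbrs ! i). i \<in> set (gadget_nbrs ! j)"
    and dist: "\<forall>i \<in> {..<15}. \<forall>j \<in> set (gadget_nbrs ! i). \<forall>q \<in> {0, 1, 2}.
        gadget_dist q j \<le> gadget_dist q i + 1"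
    unfolding lessThan_15 by (simp_all add: gadget_dist_nth cong: ball_weak_cong)
  show "i < 15" using i by (rule lessThan_iff[THEN iffD1])
  show "j < 15" using less i j by blast
  show "i \<noteq> j" using neq i j by blast
  show "(j, i) \<in> gadget_arcs"
    using \<open>j < 15\<close> sym i j by (simp only: gadget_arcs_def mem_Collect_eq case_prod_conv)
  show "gadget_dist q j \<le> gadget_dist q i + 1" if "q < 3"
  proof -
    have "q \<in> {0, 1, 2}" using that by auto
    then show ?thesis using dist i j by blast
  qed
qed

lemma card_gadget_nbrs:
  assumes "i < 15"
  shows "card (gadget_arcs `` {i}) = (if i < 3 then 2 else 3)"
proof -
  have "\<forall>i \<in> {..<15}. card (set (gadget_nbrs ! i)) = (if i < 3 then 2 else 3)"
    unfolding lessThan_15 by simp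
  moreover have "gadget_arcs `` {i} = set (gadget_nbrs ! i)"
    using assms by (auto simp: gadget_arcs_def)
  ultimately show ?thesis using assms by simp
qed

text \<open>The summand 1 accounts for the edge between gadgets that follows the passage.\<close>

definition turn_cost :: "nat \<Rightarrow> nat \<Rightarrow> nat" where
  "turn_cost q p = gadget_dist q p + 1"

lemma turn_cost_eq:
  assumes "q < 3" "p < 3" "q \<noteq> p"
  shows "turn_cost q p = (if q = 0 \<or> p = 0 then 4 else 6)"
  using assms by (auto simp: turn_cost_def gadget_dist_def less_Suc_eq numeral_3_eq_3)

lemma gadget_walk_length:
  assumes "q < 3" "x 0 = q" and "\<And>i. i < n \<Longrightarrow> (x i, x (Suc i)) \<in> gadget_arcs"
  shows "turn_cost q (x n) \<le> n + 1"
proof -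
  have zero: "gadget_dist q q = 0"
    using assms(1) by (auto simp: gadget_dist_def less_Suc_eq numeral_3_eq_3)
  have bound: "gadget_dist q (x i) \<le> gadget_dist q (x 0) + i" if "i \<le> n" for i
    using that
  proof (induction i)
    case (Suc i)
    then show ?case
      using gadget_arcs_props(5)[OF assms(3)[of i] assms(1)] by simp
  qed simp
  from bound[of n] show ?thesis
    using assms(2) zero by (simp add: turn_cost_def)
qed

text \<open>Depth-first search for paths from \<open>s\<close> that can be closed after
  \<open>n\<close> further steps. A cycle is sought only from its least vertex, which prunes every
  \<open>w\<close> below \<open>s\<close>. The conditional makes the simplifier decide the test
  before it unfolds the recursion.\<close>

fun avoids_closing :: "nat \<Rightarrow> nat \<Rightarrow> nat list \<Rightarrow> nat \<Rightarrow> bool" where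
  "avoids_closing s v vs 0 \<longleftrightarrow> s \<notin> set (gadget_nbrs ! v)"
| "avoids_closing s v vs (Suc n) \<longleftrightarrow>
     (\<forall>w \<in> set (gadget_nbrs ! v). if s < w \<and> w \<notin> set vs then avoids_closing s w (w # vs) n else True)"

lemma gadget_avoids_closing:
  assumes "s < 15"
  shows "avoids_closing s s [s] 3" and "avoids_closing s s [s] 7"
proof -
  have search: "\<forall>s \<in> {..<15}.
      avoids_closing s s [s] (Suc (Suc (Suc 0))) \<and>
      avoids_closing s s [s] (Suc (Suc (Suc (Suc (Suc (Suc (Suc 0)))))))"
    unfolding lessThan_15 by (simp cong: ball_weak_cong)
  have "3 = Suc (Suc (Suc 0))" "7 = Suc (Suc (Suc (Suc (Suc (Suc (Suc 0))))))"
    by simp_all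
  note numerals = this
  have "s \<in> {..<15}"
    using assms by (rule lessThan_iff[THEN iffD2])
  from bspec[OF search this] show "avoids_closing s s [s] 3" and "avoids_closing s s [s] 7"
    unfolding numerals by (rule conjunct1, rule conjunct2)
qed

lemma avoids_closing_walk:
  assumes "avoids_closing s (x 0) vs n" "x 0 \<in> set vs"
    and "\<And>i. i < n \<Longrightarrow> (x i, x (Suc i)) \<in> gadget_arcs"
    and "\<And>i. 0 < i \<Longrightarrow> i \<le> n \<Longrightarrow> s < x i \<and> x i \<notin> set vs"
    and "inj_on x {..n}"
  shows "(x n, s) \<notin> gadget_arcs"
  using assms
proof (induction n arbitrary: x vs)
  case 0
  then show ?case by (auto simp: gadget_arcs_def)
next
  case (Suc n)
  have "(x 0, x 1) \<in> gadget_arcs" using Suc.prems(3)[of 0] by simp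
  then have x1: "x 1 \<in> set (gadget_nbrs ! x 0)" by (simp add: gadget_arcs_def)
  have "(x (Suc n), s) \<notin> gadget_arcs"
  proof (rule Suc.IH[of "\<lambda>i. x (Suc i)" "x 1 # vs"])
    show "avoids_closing s (x (Suc 0)) (x 1 # vs) n"
      using Suc.prems(1) x1 Suc.prems(4)[of 1] by simp
    show "s < x (Suc i) \<and> x (Suc i) \<notin> set (x 1 # vs)" if "0 < i" "i \<le> n" for i
    proof -
      have "x (Suc i) \<noteq> x 1" using that Suc.prems(5) by (auto dest: inj_onD)
      then show ?thesis using Suc.prems(4)[of "Suc i"] that by simp
    qed
    show "inj_on (\<lambda>i. x (Suc i)) {..n}"
      using Suc.prems(5) by (auto simp: inj_on_def)
  qed (use Suc.prems(3) in auto)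
  then show ?case .
qed

lemma gadget_no_pow2_cycle:
  assumes x: "cyclic_seq gadget_arcs (2 ^ m) x" and m: "3 \<le> (2 :: nat) ^ m"
  shows False
proof -
  let ?l = "2 ^ m :: nat"
  have arc: "(x i, x (Suc i)) \<in> gadget_arcs" for i
    using x by (simp add: cyclic_seq_def)
  then have less: "x i < 15" for i
    by (rule gadget_arcs_props(1))
  have "card (x ` {..<?l}) = ?l"
    using x by (simp add: cyclic_seq_def card_image)
  moreover have "card (x ` {..<?l}) \<le> card {..<15 :: nat}"
    using less by (intro card_mono) auto
  ultimately have "?l < 2 ^ 4" by simp
  then have "m < 4" by (rule power_less_imp_less_exp[rotated]) simp
  with m have l: "?l = Suc 3 \<or> ?l = Suc 7"
    by (auto simp: less_Suc_eq numeral_eq_Suc)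
  \<comment> \<open>Rotation to the least vertex, where the search begins.\<close>
  define i where "i = arg_min x (\<lambda>_. True)"
  have min: "x i \<le> x j" for j
    unfolding i_def by (rule arg_min_nat_le) simp
  define y where "y j = x (j + i)" for j
  have y: "cyclic_seq gadget_arcs ?l y"
    unfolding y_def by (rule cyclic_seq_shift[OF x])
  have avoid: "\<not> avoids_closing (y 0) (y 0) [y 0] n" if n: "?l = Suc n" for n
  proof
    assume "avoids_closing (y 0) (y 0) [y 0] n"
    moreover have "y 0 < y j \<and> y j \<notin> set [y 0]" if "0 < j" "j \<le> n" for j
      using that min[of "j + i"] cyclic_seq_eq_iff[OF y, of j 0] n by (auto simp: y_def)
    moreover have "inj_on y {..n}"
      using y n by (simp add: cyclic_seq_def lessThan_Suc_atMost)
    ultimately have "(y n, y 0) \<notin> gadget_arcs"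
      using y by (intro avoids_closing_walk[where vs = "[y 0]"]) (auto simp: cyclic_seq_def)
    moreover have "y (Suc n) = y 0"
      using cyclic_seq_eq_iff[OF y, of "Suc n" 0] n by simp
    ultimately show False
      using y by (metis cyclic_seq_def)
  qed
  have "y 0 < 15" unfolding y_def by (rule less)
  note gadget_avoids_closing[OF this]
  with avoid[of 3] avoid[of 7] l show False
    by (elim disjE) (erule notE[rotated], assumption)+
qed

section \<open>Replacing the vertices of a cubic graph by gadgets\<close>

text \<open>
  A cubic graph is given by its vertices and, for each vertex \<open>v\<close>, three ports: leaving \<open>v\<close> through
  port \<open>p\<close> leads to \<open>nb v p\<close>, which is entered through its port \<open>bp v p\<close>. Walks are words of ports.
  A state \<open>(v, q)\<close> is a vertex with the port through which it was entered.
\<close>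

locale port_graph =
  fixes V :: "'a set" and nb :: "'a \<Rightarrow> nat \<Rightarrow> 'a" and bp :: "'a \<Rightarrow> nat \<Rightarrow> nat"
  assumes finite_V: "finite V" and V_nonempty: "V \<noteq> {}"
    and nb_in: "v \<in> V \<Longrightarrow> p < 3 \<Longrightarrow> nb v p \<in> V"
    and nb_neq: "v \<in> V \<Longrightarrow> p < 3 \<Longrightarrow> nb v p \<noteq> v"
    and bp_less: "v \<in> V \<Longrightarrow> p < 3 \<Longrightarrow> bp v p < 3"
    and nb_bp: "v \<in> V \<Longrightarrow> p < 3 \<Longrightarrow> nb (nb v p) (bp v p) = v"
    and bp_bp: "v \<in> V \<Longrightarrow> p < 3 \<Longrightarrow> bp (nb v p) (bp v p) = p"
begin

fun move :: "'a \<times> nat \<Rightarrow> 'a \<times> nat" where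
  "move (v, p) = (nb v p, bp v p)"

fun follow :: "'a \<times> nat \<Rightarrow> nat list \<Rightarrow> 'a \<times> nat" where
  "follow s [] = s"
| "follow s (p # ps) = follow (move (fst s, p)) ps"

fun reduced :: "'a \<times> nat \<Rightarrow> nat list \<Rightarrow> bool" where
  "reduced s [] \<longleftrightarrow> True"
| "reduced s (p # ps) \<longleftrightarrow> p < 3 \<and> p \<noteq> snd s \<and> reduced (move (fst s, p)) ps"

fun cost :: "'a \<times> nat \<Rightarrow> nat list \<Rightarrow> nat" where
  "cost s [] = 0"
| "cost s (p # ps) = turn_cost (snd s) p + cost (move (fst s, p)) ps"

fun visited :: "'a \<times> nat \<Rightarrow> nat list \<Rightarrow> 'a list" where
  "visited s [] = []"
| "visited s (p # ps) = fst s # visited (move (fst s, p)) ps"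

text \<open>Entry and exit vertices of all passages; a cycle cannot repeat them, which is what
  forces the gadgets to be distinct.\<close>

fun gates :: "'a \<times> nat \<Rightarrow> nat list \<Rightarrow> ('a \<times> nat) set" where
  "gates s [] = {}"
| "gates s (p # ps) = {s, (fst s, p)} \<union> gates (move (fst s, p)) ps"

text \<open>A state \<open>(v, p)\<close> doubles as a port vertex of the gadget at
  \<open>v\<close>, so \<open>move\<close> is both the step of a walk and the edge between two
  gadgets.\<close>

definition expansion :: "('a \<times> nat) pair_pre_digraph" where
  "expansion = \<lparr>pverts = V \<times> {..<15},
     parcs = {(a, b). fst a \<in> V \<and>
       (fst b = fst a \<and> (snd a, snd b) \<in> gadget_arcs \<or> snd a < 3 \<and> b = move a)}\<rparr>"

section \<open>The expansion as a simple cubic graph\<close>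

lemma arc_expansion_iff:
  "(a, b) \<in> parcs expansion \<longleftrightarrow> fst a \<in> V \<and>
     (fst b = fst a \<and> (snd a, snd b) \<in> gadget_arcs \<or> snd a < 3 \<and> b = move a)"
  by (simp add: expansion_def)

lemma verts_expansion: "pverts expansion = V \<times> {..<15}"
  by (simp add: expansion_def)

lemma move_move: "fst a \<in> V \<Longrightarrow> snd a < 3 \<Longrightarrow> move (move a) = a"
  by (cases a) (simp add: nb_bp bp_bp)

lemma fst_move_neq: "fst a \<in> V \<Longrightarrow> snd a < 3 \<Longrightarrow> fst (move a) \<noteq> fst a"
  by (cases a) (simp add: nb_neq)

lemma move_in: "fst a \<in> V \<Longrightarrow> snd a < 3 \<Longrightarrow> fst (move a) \<in> V \<and> snd (move a) < 3"
  by (cases a) (simp add: nb_in bp_less)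

lemma pair_graph_expansion: "pair_graph expansion"
proof -
  have wf: "a \<in> V \<times> {..<15} \<and> b \<in> V \<times> {..<15}" "a \<noteq> b" "(b, a) \<in> parcs expansion"
    if ab: "(a, b) \<in> parcs expansion" for a b
  proof -
    have a: "fst a \<in> V" using ab by (simp add: arc_expansion_iff)
    from ab consider
        (inner) "fst b = fst a" "(snd a, snd b) \<in> gadget_arcs"
      | (outer) "snd a < 3" "b = move a"
      by (auto simp: arc_expansion_iff)
    then have "(a \<in> V \<times> {..<15} \<and> b \<in> V \<times> {..<15}) \<and> a \<noteq> b \<and> (b, a) \<in> parcs expansion"
    proof cases
      case inner
      then show ?thesis
        using a gadget_arcs_props[OF inner(2)] by (auto simp: arc_expansion_iff mem_Times_iff)
    next
      case outer
      then show ?thesis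
        using a move_in[of a] move_move[of a] fst_move_neq[of a]
        by (auto simp: arc_expansion_iff mem_Times_iff)
    qed
    then show "a \<in> V \<times> {..<15} \<and> b \<in> V \<times> {..<15}" "a \<noteq> b" "(b, a) \<in> parcs expansion"
      by auto
  qed
  have fin: "finite (V \<times> {..<15 :: nat})" using finite_V by simp
  have "parcs expansion \<subseteq> (V \<times> {..<15}) \<times> (V \<times> {..<15})"
    using wf(1) by (auto simp: mem_Times_iff)
  then have fin_arcs: "finite (parcs expansion)"
    using fin by (meson finite_SigmaI finite_subset)
  show ?thesis
  proof unfold_locales
    show "symmetric (with_proj expansion)"
      using wf(3) by (auto simp: symmetric_def sym_def)
    show "fst e \<in> pverts expansion" "snd e \<in> pverts expansion" "fst e \<noteq> snd e"
      if "e \<in> parcs expansion" for e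
      using that wf[of "fst e" "snd e"] by (auto simp: verts_expansion)
  qed (use fin fin_arcs in \<open>simp_all add: verts_expansion\<close>)
qed

text \<open>The outer arc supplies the third neighbour of a port; it leads to another gadget, so
  nothing is counted twice.\<close>

lemma out_degree_expansion:
  assumes "a \<in> pverts expansion"
  shows "out_degree (with_proj expansion) a = 3"
proof -
  let ?inner = "Pair (fst a) ` (gadget_arcs `` {snd a})"
  let ?outer = "if snd a < 3 then {move a} else {}"
  have a: "fst a \<in> V" "snd a < 15"
    using assms by (auto simp: verts_expansion)
  have arcs: "out_arcs (with_proj expansion) a = Pair a ` (?inner \<union> ?outer)"
    using a by (cases a) (auto simp: out_arcs_def arc_expansion_iff image_iff)
  have fin: "finite (gadget_arcs `` {snd a})"
    using card_gadget_nbrs[OF a(2)] by (intro card_ge_0_finite) (simp split: if_splits)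
  have "?inner \<inter> ?outer = {}"
    using fst_move_neq[OF a(1)] by auto
  then have "card (?inner \<union> ?outer) = card ?inner + card ?outer"
    using fin by (intro card_Un_disjoint) auto
  also have "\<dots> = 3"
    using card_gadget_nbrs[OF a(2)] by (simp add: card_image inj_on_def)
  finally show ?thesis
    unfolding out_degree_def arcs by (simp add: card_image inj_on_def)
qed

section \<open>Cycles of the expansion as words of ports\<close>

lemma reduced_snd:
  assumes "reduced s ps" "ps \<noteq> []" "fst s \<in> V"
  shows "fst (follow s ps) \<in> V \<and> snd (follow s ps) < 3"
  using assms
proof (induction s ps rule: follow.induct)
  case (2 s p ps)
  then show ?case
    using move_in[of "(fst s, p)"] by (cases "ps = []") auto
qed simp

text \<open>Prepares a pigeonhole argument: a passage occupies two of the three ports, so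
  vertex-disjoint passages cannot share a gadget.\<close>

lemma visited_gates:
  assumes "v \<in> set (visited s ps)" "reduced s ps" "fst s \<in> V" "snd s < 3"
  shows "\<exists>a b. a < 3 \<and> b < 3 \<and> a \<noteq> b \<and> (v, a) \<in> gates s ps \<and> (v, b) \<in> gates s ps"
  using assms
proof (induction s ps rule: visited.induct)
  case (2 s p ps)
  show ?case
  proof (cases "v = fst s")
    case True
    then show ?thesis
      using 2 by (intro exI[of _ "snd s"] exI[of _ p]) auto
  next
    case False
    then show ?thesis
      using 2 move_in[of "(fst s, p)"] by fastforce
  qed
qed simp

text \<open>
  A cycle cut open at an arc between two gadgets: \<open>x 0\<close> and \<open>x n\<close> are where it leaves a gadget. The
  words of ports are read off by cutting at the first later arc leaving a gadget.
\<close>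

lemma expansion_walk_word:
  assumes "\<And>i. (x i, x (Suc i)) \<in> parcs expansion" "\<And>i. x i \<noteq> x (i + 2)"
    and "fst (x 0) \<noteq> fst (x 1)" "fst (x n) \<noteq> fst (x (Suc n))" "0 < n" "inj_on x {1..n}"
  shows "\<exists>ps. ps \<noteq> [] \<and> reduced (x 1) ps \<and> follow (x 1) ps = x (Suc n) \<and> cost (x 1) ps \<le> n \<and>
           gates (x 1) ps \<subseteq> x ` {1..n} \<and> distinct (visited (x 1) ps)"
  using assms
proof (induction n arbitrary: x rule: less_induct)
  case (less n)
  note arc = less.prems(1)
  have outer: "snd (x i) < 3 \<and> x (Suc i) = move (x i)" if "fst (x i) \<noteq> fst (x (Suc i))" for i
    using that arc[of i] by (auto simp: arc_expansion_iff)
  have inner: "(snd (x i), snd (x (Suc i))) \<in> gadget_arcs" if "fst (x i) = fst (x (Suc i))" for i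
    using that arc[of i] fst_move_neq[of "x i"] by (auto simp: arc_expansion_iff)
  have in_V: "fst (x i) \<in> V" for i
    using arc[of i] by (simp add: arc_expansion_iff)
  have x1: "x 1 = move (x 0)" "snd (x 0) < 3"
    using outer[of 0] less.prems(3) by auto
  define m where "m = (LEAST m. 0 < m \<and> fst (x m) \<noteq> fst (x (Suc m)))"
  have m: "0 < m" "fst (x m) \<noteq> fst (x (Suc m))"
    using LeastI[of "\<lambda>m. 0 < m \<and> fst (x m) \<noteq> fst (x (Suc m))" n] less.prems(4,5)
    by (simp_all add: m_def)
  have "m \<le> n"
    unfolding m_def by (rule Least_le) (use less.prems in simp)
  have before: "fst (x i) = fst (x (Suc i))" if "0 < i" "i < m" for i
    using not_less_Least[of i "\<lambda>m. 0 < m \<and> fst (x m) \<noteq> fst (x (Suc m))"] that by (auto simp: m_def)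
  have const: "fst (x i) = fst (x 1)" if "0 < i" "i \<le> m" for i
    using that
  proof (induction i)
    case (Suc i)
    then show ?case using before[of i] by (cases i) auto
  qed simp
  define v q p where "v = fst (x 1)" and "q = snd (x 1)" and "p = snd (x m)"
  have xm: "x m = (v, p)" and x1': "x 1 = (v, q)"
    using const[of m] m(1) by (simp_all add: v_def q_def p_def prod_eq_iff)
  have p: "p < 3" and next_x: "x (Suc m) = move (v, p)"
    using outer[OF m(2)] xm by auto
  have q: "q < 3"
    using move_in[OF in_V[of 0] x1(2)] by (simp add: q_def flip: x1(1))
  \<comment> \<open>Leaving through the port of entry would force \<open>m = 1\<close> by
    injectivity, and the walk would be back at \<open>x 0\<close> at index 2.\<close>
  have "p \<noteq> q"
  proof
    assume "p = q"
    then have "x m = x 1" using xm x1' by simp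
    then have "m = 1"
      using less.prems(6) m(1) \<open>m \<le> n\<close> by (auto dest: inj_onD)
    then have "x 2 = move (x 1)"
      using outer[OF m(2)] by (simp add: numeral_2_eq_2)
    then have "x 2 = x 0"
      using move_move[OF in_V[of 0] x1(2)] x1(1) by simp
    then show False
      using less.prems(2)[of 0] by (simp add: numeral_2_eq_2)
  qed
  have "(snd (x (Suc i)), snd (x (Suc (Suc i)))) \<in> gadget_arcs" if "i < m - 1" for i
    using that inner before[of "Suc i"] by simp
  \<comment> \<open>There are \<open>m - 1\<close> arcs inside the gadget; the arc that leaves it is
    the 1 in \<open>turn_cost\<close>.\<close>
  then have "turn_cost q (snd (x (Suc (m - 1)))) \<le> (m - 1) + 1"
    using q by (intro gadget_walk_length[of q "\<lambda>i. snd (x (Suc i))"]) (auto simp: q_def)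
  then have cost: "turn_cost q p \<le> m"
    using m(1) by (simp add: p_def)
  have first: "{x 1, (v, p)} \<subseteq> x ` {1..n}"
    using m(1) \<open>m \<le> n\<close> less.prems(5) by (auto simp flip: xm)
  show ?case
  proof (cases "m = n")
    case True
    then show ?thesis
      using p q \<open>p \<noteq> q\<close> cost next_x first x1' by (intro exI[of _ "[p]"]) simp
  next
    case False
    let ?y = "\<lambda>i. x (i + m)"
    have "\<exists>ps. ps \<noteq> [] \<and> reduced (?y 1) ps \<and> follow (?y 1) ps = ?y (Suc (n - m)) \<and>
        cost (?y 1) ps \<le> n - m \<and> gates (?y 1) ps \<subseteq> ?y ` {1..n - m} \<and> distinct (visited (?y 1) ps)"
    proof (rule less.IH[of "n - m" ?y])
      show "?y i \<noteq> ?y (i + 2)" for i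
        using less.prems(2)[of "i + m"] by (simp add: add_ac)
      show "inj_on ?y {1..n - m}"
      proof (rule inj_onI)
        fix i j assume "i \<in> {1..n - m}" "j \<in> {1..n - m}" "?y i = ?y j"
        then have "i + m = j + m"
          using \<open>m \<le> n\<close> by (intro inj_onD[OF less.prems(6)]) auto
        then show "i = j" by simp
      qed
      show "(?y i, ?y (Suc i)) \<in> parcs expansion" for i
        using arc[of "i + m"] by simp
      show "n - m < n" "0 < n - m"
        using m(1) False \<open>m \<le> n\<close> by simp_all
      show "fst (?y 0) \<noteq> fst (?y 1)"
        using m(2) by simp
      show "fst (?y (n - m)) \<noteq> fst (?y (Suc (n - m)))"
        using less.prems(4) \<open>m \<le> n\<close> by simp
    qed
    then obtain ps where ps: "reduced (x (Suc m)) ps" "follow (x (Suc m)) ps = x (Suc n)"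
        "cost (x (Suc m)) ps \<le> n - m" "gates (x (Suc m)) ps \<subseteq> ?y ` {1..n - m}"
        "distinct (visited (x (Suc m)) ps)"
      using \<open>m \<le> n\<close> by auto
    have sub: "gates (x (Suc m)) ps \<subseteq> x ` {Suc m..n}"
    proof
      fix g assume "g \<in> gates (x (Suc m)) ps"
      then obtain i where "i \<in> {1..n - m}" "g = x (i + m)" using ps(4) by auto
      then show "g \<in> x ` {Suc m..n}" by (intro image_eqI[of _ _ "i + m"]) auto
    qed
    have fresh: "x i \<notin> x ` {Suc m..n}" if "1 \<le> i" "i \<le> m" for i
    proof
      assume "x i \<in> x ` {Suc m..n}"
      then obtain j where "j \<in> {Suc m..n}" "x i = x j" by blast
      then have "i = j"
        using that \<open>m \<le> n\<close> by (intro inj_onD[OF less.prems(6)]) auto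
      then show False
        using \<open>j \<in> {Suc m..n}\<close> that by simp
    qed
    \<comment> \<open>A second passage through \<open>v\<close> would need two ports besides
      \<open>p\<close> and \<open>q\<close>, but there are only three.\<close>
    have "v \<notin> set (visited (x (Suc m)) ps)"
    proof
      assume "v \<in> set (visited (x (Suc m)) ps)"
      moreover have "snd (x (Suc m)) < 3"
        using move_in[OF in_V[of m]] p xm next_x by simp
      ultimately obtain a b where ab: "a < 3" "b < 3" "a \<noteq> b"
          "(v, a) \<in> gates (x (Suc m)) ps" "(v, b) \<in> gates (x (Suc m)) ps"
        using visited_gates[OF _ ps(1) in_V] by blast
      then have "(v, a) \<in> x ` {Suc m..n}" "(v, b) \<in> x ` {Suc m..n}"
        using sub by blast+
      then have "a \<notin> {p, q}" "b \<notin> {p, q}"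
        using fresh[of 1] fresh[of m] m(1) xm x1' by force+
      then show False
        using ab(1-3) p q \<open>p \<noteq> q\<close> by auto
    qed
    moreover have "x ` {Suc m..n} \<subseteq> x ` {1..n}"
      by (intro image_mono) auto
    then have "gates (x 1) (p # ps) \<subseteq> x ` {1..n}"
      using first sub x1' next_x by auto
    ultimately show ?thesis
      using ps p \<open>p \<noteq> q\<close> cost next_x \<open>m \<le> n\<close> x1'
      by (intro exI[of _ "p # ps"] conjI) simp_all
  qed
qed

lemma expansion_pow2_free:
  assumes heavy: "\<And>s ps. \<lbrakk>fst s \<in> V; snd s < 3; ps \<noteq> []; reduced s ps; follow s ps = s;
      distinct (visited s ps)\<rbrakk> \<Longrightarrow> 2 ^ k < cost s ps"
    and "m \<le> k"
  shows "\<not> has_cycle_of_length expansion (2 ^ m)"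
proof
  let ?l = "2 ^ m :: nat"
  interpret pair_graph expansion by (rule pair_graph_expansion)
  assume "has_cycle_of_length expansion ?l"
  then obtain x where l: "3 \<le> ?l" and x: "cyclic_seq (parcs expansion) ?l x"
    using has_cycle_of_length_iff[OF pair_wf_digraph] by blast
  have arc: "(x i, x (Suc i)) \<in> parcs expansion" for i
    using x by (simp add: cyclic_seq_def)
  show False
  proof (cases "\<exists>i. fst (x i) \<noteq> fst (x (Suc i))")
    case True
    then obtain s where s: "fst (x s) \<noteq> fst (x (Suc s))" by blast
    define y where "y i = x (i + s)" for i
    have y: "cyclic_seq (parcs expansion) ?l y"
      unfolding y_def by (rule cyclic_seq_shift[OF x])
    have period: "y (i + ?l) = y i" for i
      using y by (simp add: cyclic_seq_def)
    have last: "y ?l = y 0" "y (Suc ?l) = y 1"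
      using period[of 0] period[of 1] by simp_all
    have neq: "y i \<noteq> y (i + 2)" for i
      using cyclic_seq_eq_iff[OF cyclic_seq_shift[OF y, of i], of 0 2] l by (simp add: add.commute)
    \<comment> \<open>The window starts at 1 because \<open>y 0\<close> and \<open>y ?l\<close> are
      the same exit vertex.\<close>
    have inj: "inj_on y {1..?l}"
    proof (rule inj_onI)
      fix i j assume "i \<in> {1..?l}" "j \<in> {1..?l}" "y i = y j"
      moreover from this have "(i - 1) mod ?l = (j - 1) mod ?l"
        using cyclic_seq_eq_iff[OF cyclic_seq_shift[OF y, of 1], of "i - 1" "j - 1"] by simp
      ultimately show "i = j" by auto
    qed
    have out0: "fst (y 0) \<noteq> fst (y 1)" using s by (simp add: y_def)
    have out: "fst (y ?l) \<noteq> fst (y (Suc ?l))" using out0 last by simp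
    have arcs: "(y i, y (Suc i)) \<in> parcs expansion" for i
      using y by (simp add: cyclic_seq_def)
    obtain ps where ps: "ps \<noteq> []" "reduced (y 1) ps" "follow (y 1) ps = y 1" "cost (y 1) ps \<le> ?l"
        "distinct (visited (y 1) ps)"
      using expansion_walk_word[OF arcs neq out0 out _ inj] last by auto
    have "fst (y 1) \<in> V" using arcs[of 1] by (simp add: arc_expansion_iff)
    moreover from this have "snd (y 1) < 3"
      using reduced_snd[OF ps(2,1)] ps(3) by simp
    ultimately have "2 ^ k < cost (y 1) ps"
      using heavy ps by blast
    also have "\<dots> \<le> 2 ^ k"
      using ps(4) \<open>m \<le> k\<close> by (meson le_trans one_le_numeral power_increasing)
    finally show False by simp
  next
    case False
    then have "fst (x i) = fst (x 0)" for i
      by (induction i) auto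
    then have x_eq: "x i = x j \<longleftrightarrow> snd (x i) = snd (x j)" for i j
      by (metis prod_eq_iff)
    have "(snd (x i), snd (x (Suc i))) \<in> gadget_arcs" for i
    proof -
      have "fst (x (Suc i)) = fst (x i)" using False by metis
      then show ?thesis
        using arc[of i] fst_move_neq[of "x i"] by (auto simp: arc_expansion_iff)
    qed
    then have "cyclic_seq gadget_arcs ?l (\<lambda>i. snd (x i))"
      using x by (simp add: cyclic_seq_def inj_on_def x_eq)
    then show False
      using l by (rule gadget_no_pow2_cycle)
  qed
qed

theorem pow2_free_order_le_expansion:
  assumes "\<And>s ps. \<lbrakk>fst s \<in> V; snd s < 3; ps \<noteq> []; reduced s ps; follow s ps = s;
      distinct (visited s ps)\<rbrakk> \<Longrightarrow> 2 ^ k < cost s ps"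
  shows "pow2_free_order k \<le> enat (15 * card V)"
proof -
  have "pow2_free_order k \<le> enat (graph_order expansion)"
    using V_nonempty
    by (intro pow2_free_order_le pair_graph_expansion out_degree_expansion
        expansion_pow2_free[OF assms]) (auto simp: verts_expansion lessThan_empty_iff)
  then show ?thesis
    by (simp add: verts_expansion card_cartesian_product mult.commute)
qed

end

section \<open>Cubic graphs of large girth\<close>

context port_graph
begin

lemma cost_ge:
  assumes "reduced s ps" "fst s \<in> V" "snd s < 3"
  shows "4 * length ps \<le> cost s ps"
  using assms
proof (induction s ps rule: cost.induct)
  case (2 s p ps)
  then have "4 \<le> turn_cost (snd s) p"
    using turn_cost_eq[of "snd s" p] by auto
  moreover have "4 * length ps \<le> cost (move (fst s, p)) ps"
    using 2 move_in[of "(fst s, p)"] by simp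
  ultimately show ?case by simp
qed simp

lemma visited_nth:
  assumes "reduced s ps" "fst s \<in> V" "i < length ps"
  shows "visited s ps ! i \<in> V \<and>
    (\<exists>p < 3. (visited s ps @ [fst (follow s ps)]) ! Suc i = nb (visited s ps ! i) p)"
  using assms
proof (induction s ps arbitrary: i rule: visited.induct)
  case (2 s p ps)
  have IH: "j < length ps \<Longrightarrow> visited (move (fst s, p)) ps ! j \<in> V \<and>
      (\<exists>p' < 3. (visited (move (fst s, p)) ps @ [fst (follow (move (fst s, p)) ps)]) ! Suc j =
        nb (visited (move (fst s, p)) ps ! j) p')" for j
    using 2 move_in[of "(fst s, p)"] by simp
  show ?case
  proof (cases i)
    case 0
    have "(visited (move (fst s, p)) ps @ [fst (follow (move (fst s, p)) ps)]) ! 0 = nb (fst s) p"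
      by (cases ps) simp_all
    then show ?thesis using 0 2 by auto
  next
    case (Suc j)
    then show ?thesis using IH[of j] 2 by simp
  qed
qed simp

lemma length_visited: "length (visited s ps) = length ps"
  by (induction s ps rule: visited.induct) simp_all

text \<open>The visited vertices form the cycle. Length 1 would be a loop. Length 2 would lead from
  a neighbour back to the start through two different ports, that is along parallel edges, which the
  locale admits and \<open>inj\<close> excludes.\<close>

lemma closed_word_cycle:
  assumes ps: "ps \<noteq> []" "reduced s ps" "follow s ps = s" "distinct (visited s ps)"
    and s: "fst s \<in> V" "snd s < 3"
    and arc: "\<And>v p. v \<in> V \<Longrightarrow> p < 3 \<Longrightarrow> (v, nb v p) \<in> A"
    and inj: "\<And>v. v \<in> V \<Longrightarrow> inj_on (nb v) {..<3}"
  shows "3 \<le> length ps \<and> (\<exists>x. cyclic_seq A (length ps) x)"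
proof
  obtain v q where vq: "s = (v, q)" by fastforce
  have "length ps \<noteq> 1"
  proof
    assume "length ps = 1"
    then obtain p where "ps = [p]" by (auto simp: length_Suc_conv)
    then show False
      using ps s nb_neq[of v p] by (auto simp: vq)
  qed
  moreover have "length ps \<noteq> 2"
  proof
    assume "length ps = 2"
    then obtain p p' where p: "ps = [p, p']" by (auto simp: length_Suc_conv numeral_2_eq_2)
    let ?w = "nb v p"
    have "p < 3" "p' < 3" "p' \<noteq> bp v p" "nb ?w p' = v"
      using ps(2,3) by (auto simp: p vq)
    moreover have "?w \<in> V" "bp v p < 3" "nb ?w (bp v p) = v"
      using \<open>p < 3\<close> s nb_in bp_less nb_bp by (auto simp: vq)
    ultimately show False
      using inj_onD[OF inj[of ?w], of p' "bp v p"] by simp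
  qed
  ultimately show "3 \<le> length ps"
    using ps(1) by (cases ps; cases "tl ps"; cases "tl (tl ps)") auto
  let ?t = "length ps" and ?vs = "visited s ps"
  have pos: "0 < ?t" using ps(1) by simp
  have "(?vs ! (i mod ?t), ?vs ! (Suc i mod ?t)) \<in> A" for i
  proof -
    let ?j = "i mod ?t"
    have j: "?j < ?t" using pos by simp
    have "?vs ! (Suc i mod ?t) = (?vs @ [fst (follow s ps)]) ! Suc ?j"
    proof (cases "Suc ?j = ?t")
      case True
      then have "Suc i mod ?t = 0" by (simp add: mod_Suc)
      moreover have "?vs ! 0 = fst s" using ps(1) by (cases ps) simp_all
      ultimately show ?thesis using True ps(3) by (simp add: nth_append length_visited)
    next
      case False
      then show ?thesis using j by (simp add: mod_Suc nth_append length_visited)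
    qed
    then show ?thesis
      using visited_nth[OF ps(2) s(1) j] arc by auto
  qed
  moreover have "inj_on (\<lambda>i. ?vs ! (i mod ?t)) {..<?t}"
    using ps(4) by (auto simp: inj_on_def distinct_conv_nth length_visited)
  ultimately have "cyclic_seq A ?t (\<lambda>i. ?vs ! (i mod ?t))"
    using pos by (simp add: cyclic_seq_def)
  then show "\<exists>x. cyclic_seq A ?t x" by blast
qed

end

text \<open>The neighbours of each vertex are numbered arbitrarily. The back port is the number of
  \<open>v\<close> among the neighbours of its neighbour, which exists as the arcs are
  symmetric.\<close>

lemma cubic_graph_ports:
  assumes "cubic_graph G"
  obtains nb bp where "port_graph (pverts G) nb bp"
    and "\<And>v p. v \<in> pverts G \<Longrightarrow> p < 3 \<Longrightarrow> (v, nb v p) \<in> parcs G"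
    and "\<And>v. v \<in> pverts G \<Longrightarrow> inj_on (nb v) {..<3}"
proof -
  interpret pair_graph G using assms by (simp add: cubic_graph_def)
  have "\<exists>f. bij_betw f {..<3 :: nat} {w. (v, w) \<in> parcs G}" if "v \<in> pverts G" for v
  proof -
    have "out_arcs (with_proj G) v = Pair v ` {w. (v, w) \<in> parcs G}"
      by (auto simp: out_arcs_def)
    then have "card {w. (v, w) \<in> parcs G} = 3"
      using assms that by (auto simp: cubic_graph_def out_degree_def card_image inj_on_def)
    then show ?thesis
      using ex_bij_betw_nat_finite[of "{w. (v, w) \<in> parcs G}"]
      by (metis atLeast0LessThan card.infinite zero_neq_numeral)
  qed
  then obtain nb where nb: "\<And>v. v \<in> pverts G \<Longrightarrow> bij_betw (nb v) {..<3 :: nat} {w. (v, w) \<in> parcs G}"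
    by metis
  have inj: "inj_on (nb v) {..<3}" if "v \<in> pverts G" for v
    using nb[OF that] by (rule bij_betw_imp_inj_on)
  have arc: "(v, nb v p) \<in> parcs G" if "v \<in> pverts G" "p < 3" for v p
    using bij_betw_apply[OF nb[OF that(1)]] that(2) by auto
  define bp where "bp v p = the_inv_into {..<3} (nb (nb v p)) v" for v p
  have bp_spec: "bp v p < 3 \<and> nb (nb v p) (bp v p) = v" if v: "v \<in> pverts G" "p < 3" for v p
  proof -
    have w: "nb v p \<in> pverts G" "(nb v p, v) \<in> parcs G"
      using arc[OF v] in_arcsD2 arcs_symmetric by auto
    then have "v \<in> nb (nb v p) ` {..<3}"
      using nb[OF w(1)] by (auto simp: bij_betw_def)
    then show ?thesis
      using the_inv_into_into[OF inj[OF w(1)], of v "{..<3}"] f_the_inv_into_f[OF inj[OF w(1)], of v]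
      by (auto simp: bp_def)
  qed
  have "port_graph (pverts G) nb bp"
  proof
    fix v p assume v: "v \<in> pverts G" "p < (3 :: nat)"
    show "nb v p \<in> pverts G" "nb v p \<noteq> v"
      using arc[OF v] in_arcsD2 no_loops'[of v "nb v p"] by auto
    show "bp v p < 3" "nb (nb v p) (bp v p) = v"
      using bp_spec[OF v] by auto
    show "bp (nb v p) (bp v p) = p"
      using bp_spec[OF v] the_inv_into_f_f[OF inj[OF v(1)], of p] v(2) by (simp add: bp_def)
  qed (use assms pair_finite_verts in \<open>auto simp: cubic_graph_def\<close>)
  then show thesis using arc inj by (rule that)
qed

lemma pow2_free_order_le_cubic_girth_order:
  assumes "2 \<le> k" "cubic_girth_order (2 ^ (k - 2) + 1) n"
  shows "pow2_free_order k \<le> enat (15 * n)"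
proof -
  obtain G where G: "cubic_graph G" "girth G = enat (2 ^ (k - 2) + 1)" "graph_order G = n"
    using assms(2) by (auto simp: cubic_girth_order_def)
  obtain nb bp where "port_graph (pverts G) nb bp"
    and arc: "\<And>v p. v \<in> pverts G \<Longrightarrow> p < 3 \<Longrightarrow> (v, nb v p) \<in> parcs G"
    and inj: "\<And>v. v \<in> pverts G \<Longrightarrow> inj_on (nb v) {..<3}"
    using cubic_graph_ports[OF G(1)] by blast
  then interpret port_graph "pverts G" nb bp by simp
  interpret G: pair_graph G using G(1) by (simp add: cubic_graph_def)
  have heavy: "2 ^ k < cost s ps"
    if s: "fst s \<in> pverts G" "snd s < 3"
      and ps: "ps \<noteq> []" "reduced s ps" "follow s ps = s" "distinct (visited s ps)" for s ps
  proof -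
    have "has_cycle_of_length G (length ps)"
      using closed_word_cycle[OF ps s arc inj] has_cycle_of_length_iff[OF G.pair_wf_digraph] by blast
    then have "girth G \<le> enat (length ps)"
      unfolding girth_def by (intro Inf_lower) blast
    then have "2 ^ (k - 2) + 1 \<le> length ps"
      by (simp add: G(2))
    moreover have "(2 :: nat) ^ k = 4 * 2 ^ (k - 2)"
      using assms(1) by (cases k; cases "k - 1") simp_all
    ultimately show ?thesis
      using cost_ge[OF ps(2) s] by simp
  qed
  have "pow2_free_order k \<le> enat (15 * graph_order G)"
    by (rule pow2_free_order_le_expansion) (rule heavy)
  then show ?thesis
    by (simp add: G(3))
qed

section \<open>A base graph for exponent 6\<close>

text \<open>
  Modulo 37, the nonzero residues are the powers \<open>17\<^sup>i\<close>, \<open>i \<in> \<int>/36\<close>. The base graph is the truncation of the complete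
  graph on \<open>\<int>/37\<close>: each vertex \<open>z\<close> becomes a 36-cycle \<open>(i, z)\<close>, \<open>i \<in> \<int>/36\<close>, in which the vertex
  \<open>(i, z)\<close> is joined to the 36-cycle of \<open>z + 17\<^sup>i\<close>. As \<open>17\<^sup>1\<^sup>8 = -1\<close>, that edge arrives at
  \<open>i + 18\<close>. It is a Cayley graph of the affine group over \<open>\<int>/37\<close>.
\<close>

definition pow17 :: "int \<Rightarrow> int" where
  "pow17 i = 17 ^ nat (i mod 36) mod 37"

section \<open>Powers of 17 modulo 37\<close>

lemma pow17_mod: "17 ^ n mod (37 :: int) = 17 ^ (n mod 36) mod 37"
proof -
  have "(17 :: int) ^ n = 17 ^ (36 * (n div 36) + n mod 36)"
    by (simp only: mult_div_mod_eq)
  also have "\<dots> = (17 ^ 36) ^ (n div 36) * 17 ^ (n mod 36)"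
    by (simp only: power_add power_mult)
  also have "\<dots> mod 37 = ((17 ^ 36 mod 37) ^ (n div 36) * 17 ^ (n mod 36)) mod 37"
    by (metis mod_mult_left_eq power_mod)
  \<comment> \<open>Fermat: evaluation gives \<open>17 ^ 36 mod 37 = 1\<close>.\<close>
  finally show ?thesis by simp
qed

lemma pow17_add: "pow17 (i + j) = pow17 i * pow17 j mod 37"
proof -
  have "(i + j) mod 36 = (i mod 36 + j mod 36) mod 36"
    by (rule mod_add_eq[symmetric])
  then have "nat ((i + j) mod 36) = (nat (i mod 36) + nat (j mod 36)) mod 36"
    by (simp only: nat_mod_distrib nat_add_distrib pos_mod_sign zero_less_numeral add_nonneg_nonneg
        zero_le_numeral nat_numeral)
  then have "pow17 (i + j) = 17 ^ (nat (i mod 36) + nat (j mod 36)) mod 37"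
    by (simp only: pow17_def pow17_mod[symmetric])
  also have "\<dots> = pow17 i * pow17 j mod 37"
    by (simp only: pow17_def power_add mod_mult_eq)
  finally show ?thesis .
qed

lemma pow17_18: "pow17 (i + 18) = - pow17 i mod 37"
proof -
  have "pow17 18 = 36" by (simp add: pow17_def)
  then have "pow17 (i + 18) = (- pow17 i + 37 * pow17 i) mod 37"
    by (simp add: pow17_add mult.commute)
  also have "\<dots> = - pow17 i mod 37"
    by (rule mod_mult_self2)
  finally show ?thesis .
qed

lemma pow17_mod_36: "pow17 (i mod 36) = pow17 i"
  by (simp add: pow17_def)

fun base_nb :: "int \<times> int \<Rightarrow> nat \<Rightarrow> int \<times> int" where
  "base_nb (i, z) p =
    (if p = 0 then ((i + 1) mod 36, z) else if p = 1 then ((i - 1) mod 36, z)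
     else ((i + 18) mod 36, (z + pow17 i) mod 37))"

definition base_bp :: "int \<times> int \<Rightarrow> nat \<Rightarrow> nat" where
  "base_bp v p = (if p = 2 then 2 else 1 - p)"

lemma base_bp_simps [simp]: "base_bp v 0 = 1" "base_bp v (Suc 0) = 0" "base_bp v 2 = 2"
  by (simp_all add: base_bp_def)

interpretation base: port_graph "{0..<36} \<times> {0..<37}" base_nb base_bp
proof
  fix v :: "int \<times> int" and p :: nat
  assume v: "v \<in> {0..<36} \<times> {0..<37}" and p: "p < 3"
  obtain i z where iz: "v = (i, z)" "0 \<le> i" "i < 36" "0 \<le> z" "z < 37"
    using v by auto
  from p consider "p = 0" | "p = 1" | "p = 2" by linarith
  note cases = this
  show "base_nb v p \<in> {0..<36} \<times> {0..<37}"
    using cases iz by cases auto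
  have neq: "(i + d) mod 36 \<noteq> i" if "\<not> 36 dvd d" for d
    using that iz(2,3) mod_eq_dvd_iff[of "i + d" 36 i] by simp
  show "base_nb v p \<noteq> v"
    using cases by cases (use iz(1) neq[of 1] neq[of "- 1"] neq[of 18] in auto)
  show "base_bp v p < 3"
    using cases by cases (auto simp: base_bp_def)
  show "base_nb (base_nb v p) (base_bp v p) = v"
    using cases
  proof cases
    case 3
    have "((z + pow17 i) mod 37 + pow17 ((i + 18) mod 36)) mod 37 = z"
      using iz by (simp add: pow17_mod_36 pow17_18 mod_simps)
    moreover have "((i + 18) mod 36 + 18) mod 36 = i"
      using iz by (simp add: mod_simps)
    ultimately show ?thesis
      using 3 iz(1) by (simp add: base_bp_def)
  qed (use iz in \<open>simp_all add: base_bp_def mod_simps\<close>)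
  show "base_bp (base_nb v p) (base_bp v p) = p"
    using cases by cases (simp_all add: base_bp_def)
qed auto

text \<open>
  Port 0 raises and port 1 lowers \<open>i\<close>, and port 2 is a flip. The list \<open>flips\<close> records the value of
  \<open>i\<close> at each flip without the shifts by 18 of the earlier flips. These shifts change the sign of
  \<open>17\<^sup>i\<close>, so a word moves \<open>z\<close> by an alternating sum, which must vanish if the word is closed. The
  length of the word bounds the variation of the list, and a short search excludes all cases.
\<close>

definition height_step :: "nat \<Rightarrow> int" where
  "height_step p = (if p = 0 then 1 else if p = 1 then - 1 else 0)"

fun height :: "nat list \<Rightarrow> int" where
  "height [] = 0"
| "height (p # ps) = height_step p + height ps"

fun flips :: "int \<Rightarrow> nat list \<Rightarrow> int list" where
  "flips i [] = []"
| "flips i (p # ps) = (if p = 2 then i # flips i ps else flips (i + height_step p) ps)"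

fun alternating_sum :: "int list \<Rightarrow> int" where
  "alternating_sum [] = 0"
| "alternating_sum (i # is) = pow17 i - alternating_sum is"

fun variation :: "int \<Rightarrow> int list \<Rightarrow> int \<Rightarrow> int" where
  "variation i [] j = \<bar>j - i\<bar>"
| "variation i (k # ks) j = \<bar>k - i\<bar> + variation k ks j"

section \<open>Closed words and alternating sums\<close>

lemma flips_shift: "flips (i + c) ps = map (\<lambda>k. k + c) (flips i ps)"
proof (induction ps arbitrary: i)
  case (Cons p ps)
  have "flips (i + c + height_step p) ps = map (\<lambda>k. k + c) (flips (i + height_step p) ps)"
    using Cons[of "i + height_step p"] by (metis add.assoc add.commute)
  then show ?case using Cons[of i] by simp
qed simp

lemma flips_append: "flips i (ps @ qs) = flips i ps @ flips (i + height ps) qs"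
  by (induction ps arbitrary: i) (simp_all add: height_step_def algebra_simps)

text \<open>A common shift of the exponents multiplies the sum by a unit; this will allow the first
  exponent to be normalised to 0.\<close>

lemma alternating_sum_shift:
  "alternating_sum (map (\<lambda>k. k + c) ks) mod 37 = pow17 c * alternating_sum ks mod 37"
proof (induction ks)
  case (Cons k ks)
  have "alternating_sum (map (\<lambda>k. k + c) (k # ks)) mod 37 =
      (pow17 (k + c) mod 37 - alternating_sum (map (\<lambda>k. k + c) ks) mod 37) mod 37"
    by (simp add: mod_diff_eq)
  also have "\<dots> = (pow17 k * pow17 c - pow17 c * alternating_sum ks) mod 37"
    unfolding Cons pow17_add by (simp add: mod_diff_eq)
  finally show ?case by (simp add: algebra_simps)
qed simp

lemma follow_base:
  assumes "set ps \<subseteq> {..<3}" "0 \<le> z" "z < 37"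
  shows "fst (base.follow ((i mod 36, z), q) ps) =
    ((i + height ps + 18 * int (length (flips i ps))) mod 36, (z + alternating_sum (flips i ps)) mod 37)"
  using assms
proof (induction ps arbitrary: i z q)
  case (Cons p ps)
  show ?case
  proof (cases "p = 2")
    case True
    let ?ks = "flips i ps" and ?ks' = "flips (i + 18) ps" and ?z' = "(z + pow17 i) mod 37"
    have "fst (base.follow (((i + 18) mod 36, ?z'), 2) ps) =
        ((i + 18 + height ps + 18 * int (length ?ks')) mod 36, (?z' + alternating_sum ?ks') mod 37)"
      using Cons.prems(1) by (intro Cons.IH) simp_all
    moreover have "length ?ks' = length ?ks"
      by (simp add: flips_shift)
    \<comment> \<open>After a flip all later exponents are shifted by 18, which negates the rest of
      the sum; hence the alternation.\<close>
    moreover have "(?z' + alternating_sum ?ks') mod 37 = (z + pow17 i - alternating_sum ?ks) mod 37"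
    proof -
      have "pow17 18 = 36" by (simp add: pow17_def)
      then have "alternating_sum ?ks' mod 37 = (- alternating_sum ?ks + 37 * alternating_sum ?ks) mod 37"
        by (simp add: flips_shift alternating_sum_shift)
      also have "\<dots> = (- alternating_sum ?ks) mod 37"
        by (rule mod_mult_self2)
      finally have "alternating_sum ?ks' mod 37 = (- alternating_sum ?ks) mod 37" .
      then have "(z + pow17 i + alternating_sum ?ks') mod 37 =
          (z + pow17 i + - alternating_sum ?ks) mod 37"
        by (rule mod_add_cong[OF refl])
      then show ?thesis by (simp add: mod_simps)
    qed
    ultimately show ?thesis
      using True by (simp add: pow17_mod_36 mod_simps algebra_simps height_step_def)
  next
    case False
    with Cons.prems(1) have "base_nb (i mod 36, z) p = ((i + height_step p) mod 36, z)"
      by (auto simp: height_step_def mod_simps less_Suc_eq numeral_3_eq_3)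
    then show ?thesis
      using Cons.IH[of z "i + height_step p" "base_bp (i mod 36, z) p"] Cons.prems False
      by (simp add: add.assoc)
  qed
qed simp

lemma reduced_ports: "base.reduced s ps \<Longrightarrow> set ps \<subseteq> {..<3}"
proof (induction ps arbitrary: s)
  case (Cons p ps)
  then show ?case using Cons.IH[of "base.move (fst s, p)"] by simp
qed simp

lemma reduced_append:
  "base.reduced s (ps @ qs) \<longleftrightarrow> base.reduced s ps \<and> base.reduced (base.follow s ps) qs"
  by (induction ps arbitrary: s) simp_all

text \<open>Between two flips a reduced word only rises or only falls, by at least one step, so
  consecutive heights differ. The case distinction is the strengthening for the induction: entry
  through port 1 means rising, through port 0 falling, through port 2 a flip just made.\<close>

lemma flips_reduced:
  assumes "base.reduced (v, q) ps" "q < 3"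
  shows "distinct_adj (flips i ps) \<and>
    (case flips i ps of
      [] \<Rightarrow> ps \<noteq> [] \<longrightarrow> (q = 0 \<longrightarrow> height ps < 0) \<and> (q = 1 \<longrightarrow> 0 < height ps) \<and> height ps \<noteq> 0
    | k # ks \<Rightarrow> (q = 0 \<longrightarrow> k \<le> i) \<and> (q = 1 \<longrightarrow> i \<le> k) \<and> (q = 2 \<longrightarrow> k \<noteq> i))"
  using assms
proof (induction ps arbitrary: v q i)
  case (Cons p ps)
  have p: "p < 3" "p \<noteq> q" and red: "base.reduced (base_nb v p, base_bp v p) ps"
    using Cons.prems(1) by (cases v; simp)+
  have "base_bp v p < 3"
    by (simp add: base_bp_def less_imp_diff_less)
  note IH = Cons.IH[OF red this]
  from p(1) consider "p = 0" | "p = 1" | "p = 2" by linarith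
  then show ?case
  proof cases
    case 1
    then show ?thesis
      using IH[of "i + 1"] p(2)
      by (cases "ps = []") (auto simp: base_bp_def height_step_def split: list.splits)
  next
    case 2
    then show ?thesis
      using IH[of "i - 1"] p(2)
      by (cases "ps = []") (auto simp: base_bp_def height_step_def split: list.splits)
  next
    case 3
    then show ?thesis
      using IH[of i] p(2)
      by (cases "flips i ps") auto
  qed
qed simp

text \<open>
  Each maximal run of ports 0 or of ports 1 in a cyclic word pays the surcharge 2 of the turn between
  ports 1 and 2 exactly once, next to the flip at its end or at its start respectively.
\<close>

lemma cost_base:
  assumes "base.reduced (v, q) ps" "q < 3"
  shows "base.cost (v, q) ps + (if q = 0 then 2 else 0) =
    4 * length ps + 2 * length (flips i ps) + (if snd (base.follow (v, q) ps) = 0 then 2 else 0)"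
  using assms
proof (induction ps arbitrary: v q i)
  case (Cons p ps)
  have p: "p < 3" "p \<noteq> q" and red: "base.reduced (base_nb v p, base_bp v p) ps"
    using Cons.prems(1) by (cases v; simp)+
  have "base_bp v p < 3"
    by (simp add: base_bp_def less_imp_diff_less)
  note IH = Cons.IH[OF red this]
  \<comment> \<open>The extra 2 at port 0 is the surcharge that a falling run paid at its start,
    ahead of the flip counted at its end.\<close>
  have "q = 0 \<or> q = 1 \<or> q = 2" "p = 0 \<or> p = 1 \<or> p = 2"
    using Cons.prems(2) p(1) by auto
  then show ?case
    using IH[of "i + height_step p"] IH[of i] p(2) turn_cost_eq[OF Cons.prems(2) p(1)]
    by (elim disjE) (simp_all split: if_splits)
qed simp

text \<open>Each port of the word is either a flip or a unit step of the height, and the steps pay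
  for the variation.\<close>

lemma variation_flips:
  "variation i (flips i ps) (i + height ps) + int (length (flips i ps)) \<le> int (length ps)"
proof (induction ps arbitrary: i)
  case (Cons p ps)
  have step: "variation i ks j \<le> \<bar>height_step p\<bar> + variation (i + height_step p) ks j" for ks j
    by (cases ks) simp_all
  have "\<bar>height_step p\<bar> \<le> (if p = 2 then 0 else 1)"
    by (simp add: height_step_def)
  then show ?case
    using step[of "flips (i + height_step p) ps" "i + height (p # ps)"]
      Cons.IH[of "i + height_step p"] Cons.IH[of i]
    by (auto simp: height_step_def algebra_simps split: if_splits)
qed simp

lemma abs_height: "\<bar>height ps\<bar> \<le> int (length ps)"
  by (induction ps) (auto simp: height_step_def)

section \<open>Bounded search for vanishing alternating sums\<close>

lemma length_le_variation:
  "distinct_adj (k # ks) \<Longrightarrow> int (length ks) \<le> variation k ks j"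
proof (induction ks arbitrary: k)
  case (Cons k' ks)
  then have "k \<noteq> k'" "int (length ks) \<le> variation k' ks j"
    by simp_all
  then show ?case by simp
qed simp

text \<open>
  Here \<open>b\<close> bounds the remaining variation until the return to 0 and \<open>s\<close> is the alternating sum so
  far, up to sign. The search range suffices as \<open>\<bar>y\<bar>\<close> is at most half of the initial bound 13.
\<close>

fun nonvanishing :: "nat \<Rightarrow> int \<Rightarrow> int \<Rightarrow> int \<Rightarrow> bool" where
  "nonvanishing 0 b x s \<longleftrightarrow> (if x = 0 then True else s mod 37 \<noteq> 0)"
| "nonvanishing (Suc n) b x s \<longleftrightarrow>
     (\<forall>y \<in> {-6, -5, -4, -3, -2, -1, 0, 1, 2, 3, 4, 5, 6}. if y \<noteq> x \<and> \<bar>y - x\<bar> + \<bar>y\<bar> \<le> b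
       then nonvanishing n (b - \<bar>y - x\<bar>) y (pow17 y - s) else True)"

lemma abs_le_variation: "\<bar>j - i\<bar> \<le> variation i ks j"
proof (induction ks arbitrary: i)
  case (Cons k ks)
  from Cons[of k] show ?case by simp
qed simp

lemma variation_triangle: "variation i ks j \<le> variation i ks k + \<bar>j - k\<bar>"
  by (induction ks arbitrary: i) auto

text \<open>Soundness of the search. The invariant \<open>b + \<bar>x\<bar> \<le> 13\<close>
  persists by the triangle inequality and, with
  \<open>\<bar>y - x\<bar> + \<bar>y\<bar> \<le> b\<close>, gives
  \<open>2 * \<bar>y\<bar> \<le> 13\<close>. The end \<open>x = 0\<close>, exempt in the search,
  cannot occur since the last flip differs from the first.\<close>

lemma nonvanishing_alternating_sum:
  assumes "nonvanishing (length ks) b x s" "variation x ks 0 \<le> b" "b + \<bar>x\<bar> \<le> 13"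
    and "distinct_adj (x # ks)" "last (x # ks) \<noteq> 0"
  shows "(s - alternating_sum ks) mod 37 \<noteq> 0"
  using assms
proof (induction ks arbitrary: b x s)
  case Nil
  then show ?case by simp
next
  case (Cons y ks)
  have var: "\<bar>y - x\<bar> + variation y ks 0 \<le> b" and "y \<noteq> x"
    using Cons.prems(2,4) by auto
  have close: "\<bar>y - x\<bar> + \<bar>y\<bar> \<le> b"
    using var abs_le_variation[of 0 y ks] by simp
  moreover have "- 6 \<le> y \<and> y \<le> 6"
    using close Cons.prems(3) by (intro conjI; linarith)
  then have "y \<in> {-6, -5, -4, -3, -2, -1, 0, 1, 2, 3, 4, 5, 6}"
    by (simp; presburger)
  moreover have "nonvanishing (Suc (length ks)) b x s"
    using Cons.prems(1) by (simp only: length_Cons)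
  ultimately have "nonvanishing (length ks) (b - \<bar>y - x\<bar>) y (pow17 y - s)"
    unfolding nonvanishing.simps(2) using \<open>y \<noteq> x\<close> by (metis (no_types, lifting))
  then have "((pow17 y - s) - alternating_sum ks) mod 37 \<noteq> 0"
    by (rule Cons.IH) (use var close Cons.prems in \<open>auto split: if_splits\<close>)
  moreover have "s - alternating_sum (y # ks) = - ((pow17 y - s) - alternating_sum ks)"
    by simp
  ultimately show ?case
    by (metis dvd_minus_iff dvd_eq_mod_eq_0)
qed

lemma pow17_table:
  "pow17 (- 6) = 11" "pow17 (- 5) = 2" "pow17 (- 4) = 34" "pow17 (- 3) = 23" "pow17 (- 2) = 21"
  "pow17 (- 1) = 24" "pow17 0 = 1" "pow17 1 = 17" "pow17 2 = 30" "pow17 3 = 29"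
  "pow17 4 = 12" "pow17 5 = 19" "pow17 6 = 27"
  by (simp_all add: pow17_def)

text \<open>The bounds are the largest \<open>b\<close> with \<open>6 * n + 4 * b \<le> 58\<close>
  for \<open>n = 1, 3, 5\<close> further flips, where 58 is the budget 64 less 6 for the first flip.
  That flip has exponent 0, so the sum starts at 1.\<close>

lemma nonvanishing_small:
  "nonvanishing (Suc 0) 13 0 1"
  "nonvanishing (Suc (Suc (Suc 0))) 10 0 1"
  "nonvanishing (Suc (Suc (Suc (Suc (Suc 0))))) 7 0 1"
  by (simp_all add: pow17_table cong: ball_weak_cong)

text \<open>Dividing by the power at the first flip moves that flip to exponent 0. The list
  \<open>ks @ ks\<close> encodes that the last flip also differs from the first. Parity and the
  bound leave one, three or five further flips.\<close>

lemma alternating_sum_nonzero: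
  assumes "even (length ks)" "ks \<noteq> []" "distinct_adj (ks @ ks)"
    and bound: "6 * int (length ks) + 4 * variation i ks i \<le> 64"
  shows "alternating_sum ks mod 37 \<noteq> 0"
proof
  assume zero: "alternating_sum ks mod 37 = 0"
  obtain k js where ks: "ks = k # js" using assms(2) by (cases ks) auto
  define ds where "ds = map (\<lambda>j. j - k) js"
  have js: "js = map (\<lambda>d. d + k) ds"
    by (simp add: ds_def comp_def)
  have adj_js: "distinct_adj ks" and last_js: "last ks \<noteq> hd ks"
    using assms(2,3) by (simp_all add: distinct_adj_append_iff)
  have adj: "distinct_adj (0 # ds)" and last: "last (0 # ds) \<noteq> 0"
    using adj_js last_js by (auto simp: ks ds_def distinct_adj_Cons hd_map last_map
        intro!: distinct_adj_mapI inj_onI)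
  have "pow17 k * alternating_sum (0 # ds) mod 37 = 0"
    using zero alternating_sum_shift[of k "0 # ds"] by (simp add: ks js)
  then have "pow17 (- k) * (pow17 k * alternating_sum (0 # ds)) mod 37 = 0"
    by (metis mod_mult_right_eq mult_zero_right mod_0)
  also have "pow17 (- k) * (pow17 k * alternating_sum (0 # ds)) mod 37 =
      pow17 (- k + k) * alternating_sum (0 # ds) mod 37"
    unfolding pow17_add by (simp only: mod_mult_left_eq mult.assoc)
  finally have "(1 - alternating_sum ds) mod 37 = 0"
    by (simp add: pow17_table)
  have "variation (a + k) (map (\<lambda>d. d + k) ds) (c + k) = variation a ds c" for a c
    by (induction ds arbitrary: a) simp_all
  from this[of 0 0] have var: "variation 0 ds 0 = variation k js k"
    by (simp add: js)
  \<comment> \<open>Closing the tour at the first flip \<open>k\<close> instead of at the starting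
    height \<open>i\<close> does not lengthen it.\<close>
  have triangle: "variation k js k \<le> \<bar>k - i\<bar> + variation k js i"
    using variation_triangle[of k js k i] by (simp add: abs_minus_commute)
  have "int (length ds) \<le> variation k js i"
    using length_le_variation adj_js by (simp add: ks ds_def)
  moreover have sum: "6 * int (length ds) + 4 * (\<bar>k - i\<bar> + variation k js i) \<le> 58"
    using bound by (simp add: ks ds_def)
  \<comment> \<open>Together these give \<open>10 * length ds \<le> 58\<close>.\<close>
  ultimately have "int (length ds) \<le> 5"
    by presburger
  then have short: "length ds \<le> 5" by simp
  have var_le: "6 * int (length ds) + 4 * variation 0 ds 0 \<le> 58"
    unfolding var using sum triangle by presburger
  have nonvanishing: "nonvanishing (length ds) b 0 1 \<Longrightarrow> variation 0 ds 0 \<le> b \<Longrightarrow> b \<le> 13 \<Longrightarrow> False" for b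
    using nonvanishing_alternating_sum[of ds b 0 1] adj last \<open>(1 - alternating_sum ds) mod 37 = 0\<close>
    by simp
  have "odd (length ds)"
    using assms(1) by (simp add: ks ds_def)
  then obtain c where c: "length ds = 2 * c + 1" by (rule oddE)
  with short have "c = 0 \<or> c = 1 \<or> c = 2" by linarith
  with c consider "length ds = Suc 0" | "length ds = Suc (Suc (Suc 0))"
    | "length ds = Suc (Suc (Suc (Suc (Suc 0))))"
    by fastforce
  then show False
  proof cases
    case 1
    then show False using nonvanishing[of 13] nonvanishing_small(1) var_le by simp
  next
    case 2
    then show False using nonvanishing[of 10] nonvanishing_small(2) var_le by simp
  next
    case 3
    then show False using nonvanishing[of 7] nonvanishing_small(3) var_le by simp
  qed
qed

lemma base_word_cost:
  assumes s: "fst s \<in> {0..<36} \<times> {0..<37}" "snd s < 3"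
    and ps: "ps \<noteq> []" "base.reduced s ps" "base.follow s ps = s"
  shows "64 < base.cost s ps"
proof (rule ccontr)
  assume "\<not> 64 < base.cost s ps"
  then have small: "base.cost s ps \<le> 64" by simp
  obtain i z q where iz: "s = ((i, z), q)" "0 \<le> i" "i < 36" "0 \<le> z" "z < 37"
    using s(1) by (cases s) auto
  let ?ks = "flips i ps"
  let ?t = "int (length ?ks)"
  have "base.cost s ps = 4 * length ps + 2 * length ?ks"
    using cost_base[of "(i, z)" q ps i] ps(2,3) s(2) by (simp add: iz(1))
  then have len: "4 * int (length ps) + 2 * ?t \<le> 64"
    using small by linarith
  have "((i + height ps + 18 * ?t) mod 36, (z + alternating_sum ?ks) mod 37) = (i, z)"
    using follow_base[OF reduced_ports[OF ps(2)] iz(4,5), of i q] ps(3) iz by simp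
  then have closed: "(i + (height ps + 18 * ?t)) mod 36 = i mod 36"
      "(z + alternating_sum ?ks) mod 37 = z mod 37"
    using iz by (simp_all add: add.assoc)
  then have zero: "alternating_sum ?ks mod 37 = 0" and "36 dvd height ps + 18 * ?t"
    by (simp_all add: mod_eq_dvd_iff mod_eq_0_iff_dvd)
  then obtain c where "height ps + 18 * ?t = 36 * c" by blast
  then have c: "height ps = 18 * (2 * c - ?t)" by simp
  \<comment> \<open>The height is a multiple of 18, while a word of cost at most 64 has at most 16
    ports. So the height is 0 and the number of flips is even.\<close>
  have "\<bar>height ps\<bar> \<le> 16"
    using abs_height[of ps] len by linarith
  then have "18 * \<bar>2 * c - ?t\<bar> \<le> 16"
    by (simp add: c abs_mult)
  then have "\<bar>2 * c - ?t\<bar> < 1" by presburger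
  then have "2 * c - ?t = 0" by simp
  then have height: "height ps = 0" and "even ?t"
    using c by (simp, presburger)
  \<comment> \<open>Doubling the word makes its last flip adjacent to its first.\<close>
  have "base.reduced ((i, z), q) (ps @ ps)"
    using ps by (simp add: reduced_append iz(1))
  then have "distinct_adj (flips i (ps @ ps))"
    using flips_reduced s(2) iz(1) by fastforce
  then have adj: "distinct_adj (?ks @ ?ks)"
    by (simp add: flips_append height)
  \<comment> \<open>A nonempty reduced word without flips is monotone, hence of nonzero
    height.\<close>
  have "?ks \<noteq> []"
    using flips_reduced[of "(i, z)" q ps i] ps(1,2) s(2) height by (auto simp: iz(1))
  moreover have "6 * ?t + 4 * variation i ?ks i \<le> 64"
    using variation_flips[of i ps] len height by simp
  ultimately show False
    using alternating_sum_nonzero[of ?ks i] adj zero \<open>even ?t\<close> by simp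
qed

lemma pow2_free_order_6: "pow2_free_order 6 \<le> enat (15 * 1332)"
proof -
  have "pow2_free_order 6 \<le> enat (15 * card ({0..<36 :: int} \<times> {0..<37 :: int}))"
    by (rule base.pow2_free_order_le_expansion) (simp add: base_word_cost)
  then show ?thesis by (simp add: card_cartesian_product)
qed

theorem theorem5p1:
  shows "(\<forall>k \<ge> 4. \<forall>n\<^sub>3. cubic_girth_order (2 ^ (k - 2) + 1) n\<^sub>3 \<longrightarrow>
            pow2_free_order k \<le> enat (15 * n\<^sub>3))
         \<and> pow2_free_order 6 \<le> enat (15 * 2176) \<and> (15 * 2176 :: nat) = 32640"
proof -
  have "pow2_free_order k \<le> enat (15 * n)" if "4 \<le> k" "cubic_girth_order (2 ^ (k - 2) + 1) n" for k n
    using that by (intro pow2_free_order_le_cubic_girth_order) simp_all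
  moreover have "pow2_free_order 6 \<le> enat (15 * 2176)"
    by (rule order_trans[OF pow2_free_order_6]) simp
  ultimately show ?thesis by simp
qed

end
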